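(* There exists a global constant $\mathbf K>0$ such that for all $M\in\mathbb N$ and all $\mathcal A\subset\{0,\dots,M-1\}$ with $1<|\mathcal A|<M$, with $\delta=\log|\mathcal A|/\log M$ and $\beta=\beta(M,\mathcal A)$ the fractal uncertainty exponent, $$\beta\ \ge\ -\frac{\log r_2}{2\log M}\ \ge\ \frac12-\delta+\frac1{\mathbf KM^8\log M}.$$
   Context: $\mathbb Z_N=\mathbb Z/N\mathbb Z\simeq\{0,\dots,N-1\}$; $\ell^2_N$ is the space of functions $u:\mathbb Z_N\to\mathbb C$ with $\|u\|_{\ell^2_N}^2=\sum_j|u(j)|^2$; $\mathcal F_Nu(j)=\frac1{\sqrt N}\sum_{\ell=0}^{N-1}\exp(-2\pi ij\ell/N)u(\ell)$; $\mathbf 1_X$ is multiplication by the indicator function of $X\subset\mathbb Z_N$. For $N=M^k$: $\mathcal C_k=\{\sum_{j=0}^{k-1}a_jM^j\mid a_0,\dots,a_{k-1}\in\mathcal A\}\subset\mathbb Z_N$ and $r_k=\|\mathbf 1_{\mathcal C_k}\mathcal F_N\mathbf 1_{\mathcal C_k}\|_{\ell^2_N\to\ell^2_N}$. The fractal uncertainty exponent is $\beta(M,\mathcal A)=-\lim_{k\to\infty}\frac{\log r_k}{k\log M}$ (the limit exists). *)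

theory Defs
  imports "HOL-Analysis.Analysis"
begin

text \<open>
  The group of integers modulo \<open>N\<close> is identified with \<open>{..<N}\<close>.  An element of the space
  of complex functions on it is represented by a function \<open>u :: nat \<Rightarrow> complex\<close>, of which only
  the values on \<open>{..<N}\<close> are relevant: the norm and the operators below never use the others.
\<close>

definition l2_norm :: "nat \<Rightarrow> (nat \<Rightarrow> complex) \<Rightarrow> real" where
  "l2_norm N u = L2_set (\<lambda>j. cmod (u j)) {..<N}"

definition l2_opnorm :: "nat \<Rightarrow> ((nat \<Rightarrow> complex) \<Rightarrow> (nat \<Rightarrow> complex)) \<Rightarrow> real" where
  "l2_opnorm N T = (SUP u \<in> {u. l2_norm N u \<le> 1}. l2_norm N (T u))"

definition fourier :: "nat \<Rightarrow> (nat \<Rightarrow> complex) \<Rightarrow> (nat \<Rightarrow> complex)" where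
  "fourier N u = (\<lambda>j. complex_of_real (1 / sqrt (real N)) *
     (\<Sum>l<N. exp (- 2 * complex_of_real pi * \<i> * of_nat j * of_nat l / of_nat N) * u l))"

definition mult_ind :: "nat set \<Rightarrow> (nat \<Rightarrow> complex) \<Rightarrow> (nat \<Rightarrow> complex)" where
  "mult_ind X u = (\<lambda>j. indicator X j * u j)"

text \<open>
  For an alphabet \<open>A \<subseteq> {..<M}\<close> the sums below are less than \<open>M ^ k\<close>, so they
  are already the representatives modulo \<open>M ^ k\<close>.
\<close>

definition cantor_set :: "nat \<Rightarrow> nat set \<Rightarrow> nat \<Rightarrow> nat set" where
  "cantor_set M A k = {\<Sum>j<k. a j * M ^ j | a. \<forall>j<k. a j \<in> A}"

definition cantor_norm :: "nat \<Rightarrow> nat set \<Rightarrow> nat \<Rightarrow> real" where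
  "cantor_norm M A k = l2_opnorm (M ^ k)
     (mult_ind (cantor_set M A k) \<circ> fourier (M ^ k) \<circ> mult_ind (cantor_set M A k))"

definition fup_exponent :: "nat \<Rightarrow> nat set \<Rightarrow> real" where
  "fup_exponent M A = - lim (\<lambda>k. ln (cantor_norm M A k) / (real k * ln (real M)))"

definition cantor_dim :: "nat \<Rightarrow> nat set \<Rightarrow> real" where
  "cantor_dim M A = ln (real (card A)) / ln (real M)"

end

theory Submission
  imports Defs
begin

text \<open>
  Write \<open>r\<^sub>k\<close> for \<^term>\<open>cantor_norm M A k\<close> and \<open>n\<close> for the size of the alphabet.

  The first inequality comes from \<open>r\<^bsub>k+m\<^esub> \<le> r\<^sub>k r\<^sub>m\<close>: the Fourier
  transform on \<open>N\<^sub>1 N\<^sub>2\<close> points factors, as in the fast Fourier transform, into transforms on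
  \<open>N\<^sub>1\<close> and on \<open>N\<^sub>2\<close> points with a unimodular twist between them, and a Cantor set of order
  \<open>k + m\<close> is compatible with both ways of splitting off its digits
  (\<open>fourier_norm_mult_le\<close>). A single matrix entry already gives
  \<open>r\<^sub>k \<ge> M\<^bsup>-k/2\<^esup>\<close>, so Fekete's lemma applies to \<open>ln r\<^sub>k\<close>: the sequence
  \<open>ln r\<^sub>k / k\<close> converges to its infimum, which is at most its value at \<open>k = 2\<close>.

  For the second inequality, \<open>r\<^sub>2\<close> is the norm of a square matrix of size \<open>n\<^sup>2\<close> whose entries
  have modulus \<open>1 / M\<close>. Its Hilbert--Schmidt norm \<open>n\<^sup>2 / M\<close> corresponds exactly to the exponent
  \<open>1/2 - \<delta>\<close>, and the norm would equal it only if all rows were parallel. They are not: if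
  \<open>l\<close> and \<open>m\<close> in the Cantor set differ only in the lowest digit, then
  \<open>0 < (l - m)\<^sup>2 < M\<^sup>2\<close>, so the columns \<open>l\<close> and \<open>m\<close> have different relative phases in the
  rows \<open>l\<close> and \<open>m\<close>, and \<open>exp (- 2 \<pi> i (l - m)\<^sup>2 / M\<^sup>2)\<close> is an \<open>M\<^sup>2\<close>-th root of unity
  other than 1. Such a root \<open>z\<close> satisfies \<open>cmod (1 + z) \<le> 2 - M\<^bsup>-4\<^esup>\<close>. Hence every row of the Gram
  matrix has an entry that loses \<open>M\<^bsup>-4\<^esup>\<close> against the trivial bound, and Schur's
  test gives \<open>M\<^sup>2 r\<^sub>2\<^sup>2 \<le> n\<^sup>4 - M\<^bsup>-4\<^esup>\<close> (\<open>fourier_energy_le_gap\<close>). Relative to \<open>n\<^sup>4 \<le> M\<^sup>4\<close>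
  this is a gain of at least \<open>M\<^bsup>-8\<^esup>\<close>.
\<close>

section \<open>Characters\<close>

definition ep :: "real \<Rightarrow> complex" where
  "ep x = cis (- (2 * pi * x))"

lemma ep_add: "ep (x + y) = ep x * ep y"
  by (simp add: ep_def cis_mult ring_distribs)

lemma cnj_ep: "cnj (ep x) = ep (- x)"
  by (simp add: ep_def cis_cnj)

lemma norm_ep [simp]: "cmod (ep x) = 1"
  by (simp add: ep_def)

lemma ep_of_nat [simp]: "ep (real m) = 1"
proof -
  have "ep (real m) = cis (- (2 * pi)) ^ m"
    by (simp add: ep_def Complex.DeMoivre mult_ac)
  also have "cis (- (2 * pi)) = 1"
    by (simp add: cis.ctr complex_eq_iff)
  finally show ?thesis by simp
qed

lemma ep_power: "ep x ^ m = ep (real m * x)"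
  by (simp add: ep_def Complex.DeMoivre mult_ac)

lemma ep_eq_1_imp_int: "ep x = 1 \<Longrightarrow> x \<in> \<int>"
proof -
  assume "ep x = 1"
  then have "cos (2 * pi * x) = 1"
    by (simp add: ep_def complex_eq_iff)
  then obtain k :: int where "2 * pi * x = real_of_int k * 2 * pi"
    by (auto simp: cos_one_2pi_int)
  then have "x = of_int k" by simp
  then show "x \<in> \<int>" by simp
qed

section \<open>The norm of the restricted Fourier transform as a quadratic inequality\<close>

text \<open>
  The squared norm of the restricted transform, without the factor \<open>1 / N\<close>. All sums run over \<open>X\<close>,
  so that bounds on the operator norm turn into inequalities between two quadratic
  forms on functions on \<open>X\<close>, valid for every \<open>u\<close> without normalisation.
\<close>

definition fourier_energy :: "nat \<Rightarrow> nat set \<Rightarrow> (nat \<Rightarrow> complex) \<Rightarrow> real" where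
  "fourier_energy N X u =
     (\<Sum>j\<in>X. (cmod (\<Sum>l\<in>X. ep (real j * real l / real N) * u l))\<^sup>2)"

definition fourier_norm :: "nat \<Rightarrow> nat set \<Rightarrow> real" where
  "fourier_norm N X = l2_opnorm N (mult_ind X \<circ> fourier N \<circ> mult_ind X)"

lemma l2_norm_restricted_fourier:
  assumes "X \<subseteq> {..<N}" "N > 0"
  shows "(l2_norm N ((mult_ind X \<circ> fourier N \<circ> mult_ind X) u))\<^sup>2 = fourier_energy N X u / real N"
proof -
  have kernel: "exp (- 2 * complex_of_real pi * \<i> * of_nat j * of_nat l / of_nat N)
      = ep (real j * real l / real N)" for j l
    unfolding ep_def cis_conv_exp by (rule arg_cong[where f = exp]) (simp add: mult_ac)
  have inner: "fourier N (mult_ind X u) j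
      = complex_of_real (1 / sqrt (real N)) * (\<Sum>l\<in>X. ep (real j * real l / real N) * u l)" for j
  proof -
    have "(\<Sum>l<N. ep (real j * real l / real N) * mult_ind X u l)
        = (\<Sum>l\<in>X. ep (real j * real l / real N) * u l)"
      using assms by (intro sum.mono_neutral_cong_right) (auto simp: mult_ind_def)
    then show ?thesis unfolding fourier_def kernel by simp
  qed
  have "(l2_norm N ((mult_ind X \<circ> fourier N \<circ> mult_ind X) u))\<^sup>2
      = (\<Sum>j<N. (cmod (indicator X j * fourier N (mult_ind X u) j))\<^sup>2)"
    unfolding l2_norm_def L2_set_def by (simp add: mult_ind_def sum_nonneg)
  also have "\<dots> = (\<Sum>j\<in>X. (cmod (fourier N (mult_ind X u) j))\<^sup>2)"
    using assms by (intro sum.mono_neutral_cong_right) (auto simp: indicator_def)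
  also have "\<dots> = (\<Sum>j\<in>X. (cmod (\<Sum>l\<in>X. ep (real j * real l / real N) * u l))\<^sup>2 / real N)"
    using assms by (intro sum.cong refl) (simp add: inner norm_mult norm_divide power_divide)
  finally show ?thesis by (simp add: fourier_energy_def sum_divide_distrib)
qed

lemma fourier_energy_scale:
  "fourier_energy N X (\<lambda>l. c * u l) = (cmod c)\<^sup>2 * fourier_energy N X u"
proof -
  have "(\<Sum>l\<in>X. ep (real j * real l / real N) * (c * u l))
      = c * (\<Sum>l\<in>X. ep (real j * real l / real N) * u l)" for j
    by (simp add: sum_distrib_left mult_ac)
  then show ?thesis
    unfolding fourier_energy_def by (simp only: norm_mult power_mult_distrib flip: sum_distrib_left)
qed

lemma fourier_energy_cong:
  "(\<And>l. l \<in> X \<Longrightarrow> u l = v l) \<Longrightarrow> fourier_energy N X u = fourier_energy N X v"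
  by (simp add: fourier_energy_def)

lemma sum_le_l2_norm:
  assumes "X \<subseteq> {..<N}"
  shows "(\<Sum>l\<in>X. (cmod (u l))\<^sup>2) \<le> (l2_norm N u)\<^sup>2"
proof -
  have "(\<Sum>l\<in>X. (cmod (u l))\<^sup>2) \<le> (\<Sum>l<N. (cmod (u l))\<^sup>2)"
    using assms by (intro sum_mono2) auto
  then show ?thesis by (simp add: l2_norm_def L2_set_def sum_nonneg)
qed

lemma l2_norm_nonneg: "l2_norm N u \<ge> 0"
  by (simp add: l2_norm_def)

text \<open>
  The operator norm is a supremum of reals, so that it bounds its members only once
  they are known to be bounded; any crude bound serves.
\<close>

lemma bdd_above_restricted_fourier:
  assumes X: "X \<subseteq> {..<N}" and N: "N > 0"
  shows "bdd_above ((\<lambda>u. l2_norm N ((mult_ind X \<circ> fourier N \<circ> mult_ind X) u)) ` {u. l2_norm N u \<le> 1})"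
proof (rule bdd_aboveI2)
  fix u assume "u \<in> {u. l2_norm N u \<le> 1}"
  then have "(l2_norm N u)\<^sup>2 \<le> 1"
    using l2_norm_nonneg[of N u] by (simp add: power_le_one)
  then have le: "(\<Sum>l\<in>X. (cmod (u l))\<^sup>2) \<le> 1"
    using sum_le_l2_norm[OF X, of u] by linarith
  have fin: "finite X" using X finite_subset by blast
  have one: "cmod (u l) \<le> 1" if "l \<in> X" for l
  proof -
    have "(cmod (u l))\<^sup>2 \<le> (\<Sum>l\<in>X. (cmod (u l))\<^sup>2)"
      using that fin by (intro member_le_sum) auto
    then have "(cmod (u l))\<^sup>2 \<le> 1\<^sup>2" using le by simp
    then show ?thesis by (rule power2_le_imp_le) simp
  qed
  have "cmod (\<Sum>l\<in>X. ep (real j * real l / real N) * u l) \<le> real (card X)" for j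
  proof -
    have "(\<Sum>l\<in>X. cmod (ep (real j * real l / real N) * u l)) \<le> (\<Sum>l\<in>X. 1)"
      using one by (intro sum_mono) (simp add: norm_mult)
    then show ?thesis using norm_sum[of _ X] order_trans by fastforce
  qed
  then have "fourier_energy N X u \<le> (\<Sum>j\<in>X. (real (card X))\<^sup>2)"
    unfolding fourier_energy_def by (intro sum_mono power_mono) auto
  then have "(l2_norm N ((mult_ind X \<circ> fourier N \<circ> mult_ind X) u))\<^sup>2
      \<le> (\<Sum>j\<in>X. (real (card X))\<^sup>2) / real N"
    unfolding l2_norm_restricted_fourier[OF X N] by (simp add: divide_right_mono)
  then show "l2_norm N ((mult_ind X \<circ> fourier N \<circ> mult_ind X) u)
      \<le> sqrt ((\<Sum>j\<in>X. (real (card X))\<^sup>2) / real N)"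
    by (rule real_le_rsqrt)
qed

lemma fourier_norm_nonneg:
  assumes "X \<subseteq> {..<N}" "N > 0"
  shows "fourier_norm N X \<ge> 0"
proof -
  have "l2_norm N (\<lambda>_. 0) \<le> 1" by (simp add: l2_norm_def L2_set_def)
  then have "l2_norm N ((mult_ind X \<circ> fourier N \<circ> mult_ind X) (\<lambda>_. 0)) \<le> fourier_norm N X"
    unfolding fourier_norm_def l2_opnorm_def
    by (intro cSUP_upper bdd_above_restricted_fourier assms) simp
  then show ?thesis using l2_norm_nonneg order_trans by blast
qed

text \<open>
  Together with \<open>fourier_norm_leI\<close> below, this describes \<open>fourier_norm\<close> as the best constant in
  a quadratic inequality; the definition as a supremum is not opened again. The inequality follows
  by homogeneity from the unit ball, after normalising \<open>u\<close> and cutting it off to \<open>X\<close>.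
\<close>

lemma fourier_energy_le:
  assumes X: "X \<subseteq> {..<N}" and N: "N > 0"
  shows "fourier_energy N X u \<le> real N * (fourier_norm N X)\<^sup>2 * (\<Sum>l\<in>X. (cmod (u l))\<^sup>2)"
proof -
  have fin: "finite X" using X finite_subset by blast
  define s where "s = (\<Sum>l\<in>X. (cmod (u l))\<^sup>2)"
  show ?thesis
  proof (cases "s = 0")
    case True
    then have "\<And>l. l \<in> X \<Longrightarrow> u l = 0"
      using fin unfolding s_def by (subst (asm) sum_nonneg_eq_0_iff) auto
    then have "fourier_energy N X u = 0" by (simp add: fourier_energy_def)
    then show ?thesis by (simp add: sum_nonneg)
  next
    case False
    then have s: "s > 0" unfolding s_def by (simp add: order_less_le sum_nonneg)
    define c where "c = complex_of_real (1 / sqrt s)"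
    have c: "(cmod c)\<^sup>2 = 1 / s"
      using s by (simp add: c_def norm_divide power_divide)
    define v where "v = mult_ind X (\<lambda>l. c * u l)"
    have "(l2_norm N v)\<^sup>2 = (\<Sum>l<N. (cmod (v l))\<^sup>2)"
      by (simp add: l2_norm_def L2_set_def sum_nonneg)
    also have "\<dots> = (\<Sum>l\<in>X. (cmod (c * u l))\<^sup>2)"
      using X by (intro sum.mono_neutral_cong_right) (auto simp: v_def mult_ind_def)
    also have "\<dots> = 1"
      using s by (simp add: norm_mult power_mult_distrib c flip: sum_distrib_left s_def)
         (simp add: s_def flip: sum_divide_distrib)
    finally have "l2_norm N v \<le> 1"
      using l2_norm_nonneg[of N v] by (simp add: power2_eq_1_iff)
    then have "l2_norm N ((mult_ind X \<circ> fourier N \<circ> mult_ind X) v) \<le> fourier_norm N X"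
      unfolding fourier_norm_def l2_opnorm_def
      by (intro cSUP_upper bdd_above_restricted_fourier assms) simp
    then have "fourier_energy N X v / real N \<le> (fourier_norm N X)\<^sup>2"
      unfolding l2_norm_restricted_fourier[OF assms, symmetric]
      using l2_norm_nonneg by (intro power_mono)
    moreover have "fourier_energy N X v = fourier_energy N X u / s"
    proof -
      have "fourier_energy N X v = fourier_energy N X (\<lambda>l. c * u l)"
        by (intro fourier_energy_cong) (simp add: v_def mult_ind_def)
      then show ?thesis by (simp add: fourier_energy_scale c)
    qed
    ultimately have "fourier_energy N X u / s / real N \<le> (fourier_norm N X)\<^sup>2" by simp
    then show ?thesis using s N by (simp add: field_simps s_def)
  qed
qed

lemma fourier_norm_leI:
  assumes X: "X \<subseteq> {..<N}" and N: "N > 0" and R: "R \<ge> 0"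
    and le: "\<And>u. fourier_energy N X u \<le> real N * R\<^sup>2 * (\<Sum>l\<in>X. (cmod (u l))\<^sup>2)"
  shows "fourier_norm N X \<le> R"
  unfolding fourier_norm_def l2_opnorm_def
proof (rule cSUP_least)
  have "l2_norm N (\<lambda>_. 0) \<le> 1" by (simp add: l2_norm_def L2_set_def)
  then show "{u. l2_norm N u \<le> 1} \<noteq> {}" by blast
next
  fix u assume "u \<in> {u. l2_norm N u \<le> 1}"
  then have "(l2_norm N u)\<^sup>2 \<le> 1"
    using l2_norm_nonneg[of N u] by (simp add: power_le_one)
  then have "(\<Sum>l\<in>X. (cmod (u l))\<^sup>2) \<le> 1"
    using sum_le_l2_norm[OF X, of u] by linarith
  then have "fourier_energy N X u \<le> real N * R\<^sup>2 * 1"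
    by (intro order_trans[OF le] mult_left_mono) auto
  then have "(l2_norm N ((mult_ind X \<circ> fourier N \<circ> mult_ind X) u))\<^sup>2 \<le> R\<^sup>2"
    unfolding l2_norm_restricted_fourier[OF X N] using N by (simp add: field_simps)
  then show "l2_norm N ((mult_ind X \<circ> fourier N \<circ> mult_ind X) u) \<le> R"
    using R by (rule power2_le_imp_le)
qed

text \<open>The transform of a point mass has modulus \<open>1 / sqrt N\<close> everywhere.\<close>

lemma fourier_norm_lower:
  assumes X: "X \<subseteq> {..<N}" and N: "N > 0" and "X \<noteq> {}"
  shows "1 / sqrt (real N) \<le> fourier_norm N X"
proof -
  obtain x where x: "x \<in> X" using assms by blast
  have fin: "finite X" using X finite_subset by blast
  define u where "u = (\<lambda>l. if l = x then 1 else 0 :: complex)"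
  have "(\<Sum>l\<in>X. ep (real j * real l / real N) * u l) = ep (real j * real x / real N)" for j
    using x fin by (simp add: u_def if_distrib sum.delta cong: if_cong)
  then have "fourier_energy N X u = real (card X)" by (simp add: fourier_energy_def)
  moreover have "(\<Sum>l\<in>X. (cmod (u l))\<^sup>2) = 1"
    using x fin by (simp add: u_def if_distrib[where f = cmod] if_distrib[where f = "\<lambda>t. t\<^sup>2"] sum.delta cong: if_cong)
  ultimately have "real (card X) \<le> real N * (fourier_norm N X)\<^sup>2"
    using fourier_energy_le[OF X N, of u] by simp
  moreover have "card X \<ge> 1" using x fin card_gt_0_iff[of X] by fastforce
  ultimately have "1 \<le> real N * (fourier_norm N X)\<^sup>2" by linarith
  then have "1 / real N \<le> (fourier_norm N X)\<^sup>2" using N by (simp add: field_simps)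
  then have "sqrt (1 / real N) \<le> fourier_norm N X"
    using fourier_norm_nonneg[OF X N] by (intro real_le_lsqrt)
  then show ?thesis by (simp add: real_sqrt_divide)
qed

section \<open>Submultiplicativity\<close>

lemma inj_on_digits:
  fixes N :: nat
  assumes "X \<subseteq> {..<N}"
  shows "inj_on (\<lambda>(x, y). x + N * y) (X \<times> Y)"
proof (rule inj_onI, clarify)
  fix x y x' y' assume *: "x \<in> X" "x' \<in> X" "x + N * y = x' + N * y'"
  then have "x < N" "x' < N" using assms by auto
  moreover have "(x + N * y) mod N = (x' + N * y') mod N" 
    "(x + N * y) div N = (x' + N * y') div N" using * by auto
  ultimately show "x = x' \<and> y = y'" by auto
qed

lemma sum_digits:
  fixes N :: nat and f :: "nat \<Rightarrow> 'a::comm_monoid_add"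
  assumes "X \<subseteq> {..<N}"
  shows "(\<Sum>z\<in>(\<lambda>(x, y). x + N * y) ` (X \<times> Y). f z) = (\<Sum>x\<in>X. \<Sum>y\<in>Y. f (x + N * y))"
  unfolding sum.reindex[OF inj_on_digits[OF assms]] by (simp add: sum.cartesian_product case_prod_unfold)

text \<open>
  This is the fast Fourier transform. For \<open>x = x\<^sub>1 + N\<^sub>1 x\<^sub>2\<close> and \<open>y = y\<^sub>2 + N\<^sub>2 y\<^sub>1\<close> the product
  \<open>x y / (N\<^sub>1 N\<^sub>2)\<close> is, modulo integers,
  \<open>x\<^sub>1 y\<^sub>1 / N\<^sub>1 + x\<^sub>2 y\<^sub>2 / N\<^sub>2 + x\<^sub>1 y\<^sub>2 / (N\<^sub>1 N\<^sub>2)\<close>. The first term is a transform in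
  \<open>y\<^sub>1\<close> for each fixed \<open>y\<^sub>2\<close>, the second one a transform in \<open>y\<^sub>2\<close> for each fixed \<open>x\<^sub>1\<close>, and the third
  one a phase that does not change absolute values. The input is split with the high digits in
  \<open>X1\<close> and the output with the low digits in \<open>X1\<close>; this is why \<open>X\<close> must be described in both orders.
\<close>

lemma fourier_norm_mult_le:
  assumes X1: "X1 \<subseteq> {..<N1}" and X2: "X2 \<subseteq> {..<N2}" and N1: "N1 > 0" and N2: "N2 > 0"
    and X_fst: "X = (\<lambda>(x, y). x + N1 * y) ` (X1 \<times> X2)"
    and X_snd: "X = (\<lambda>(x, y). x + N2 * y) ` (X2 \<times> X1)"
    and X: "X \<subseteq> {..<N1 * N2}"
  shows "fourier_norm (N1 * N2) X \<le> fourier_norm N1 X1 * fourier_norm N2 X2"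
proof (rule fourier_norm_leI[OF X])
  let ?r1 = "fourier_norm N1 X1" and ?r2 = "fourier_norm N2 X2"
  show "N1 * N2 > 0" "?r1 * ?r2 \<ge> 0"
    using N1 N2 by (simp_all add: fourier_norm_nonneg X1 X2)
  fix u :: "nat \<Rightarrow> complex"
  define g where "g x1 y2 = (\<Sum>y1\<in>X1. ep (real x1 * real y1 / real N1) * u (y2 + N2 * y1))" for x1 y2
  have kernel: "ep (real (x1 + N1 * x2) * real (y2 + N2 * y1) / real (N1 * N2))
     = ep (real x2 * real y2 / real N2) * ep (real x1 * real y2 / real (N1 * N2))
       * ep (real x1 * real y1 / real N1)" for x1 x2 y1 y2
  proof -
    have "real (x1 + N1 * x2) * real (y2 + N2 * y1) / real (N1 * N2)
       = real x2 * real y2 / real N2 + real x1 * real y2 / real (N1 * N2)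
        + real x1 * real y1 / real N1 + real (x2 * y1)"
      using N1 N2 by (simp add: field_simps)
    then show ?thesis by (simp only: ep_add ep_of_nat mult_1_right)
  qed
  have row: "(\<Sum>l\<in>X. ep (real (x1 + N1 * x2) * real l / real (N1 * N2)) * u l)
     = (\<Sum>y2\<in>X2. ep (real x2 * real y2 / real N2) * (ep (real x1 * real y2 / real (N1 * N2)) * g x1 y2))"
    for x1 x2
    unfolding X_snd sum_digits[OF X2] kernel g_def by (simp add: sum_distrib_left mult_ac)
  have "fourier_energy (N1 * N2) X u
      = (\<Sum>x1\<in>X1. \<Sum>x2\<in>X2. (cmod (\<Sum>l\<in>X. ep (real (x1 + N1 * x2) * real l / real (N1 * N2)) * u l))\<^sup>2)"
    unfolding fourier_energy_def by (subst (1) X_fst) (rule sum_digits[OF X1])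
  also have "\<dots> = (\<Sum>x1\<in>X1. fourier_energy N2 X2
      (\<lambda>y2. ep (real x1 * real y2 / real (N1 * N2)) * g x1 y2))"
    unfolding row fourier_energy_def ..
  also have "\<dots> \<le> (\<Sum>x1\<in>X1. real N2 * ?r2\<^sup>2 *
      (\<Sum>y2\<in>X2. (cmod (ep (real x1 * real y2 / real (N1 * N2)) * g x1 y2))\<^sup>2))"
    by (intro sum_mono fourier_energy_le X2 N2)
  also have "\<dots> = real N2 * ?r2\<^sup>2 * (\<Sum>x1\<in>X1. \<Sum>y2\<in>X2. (cmod (g x1 y2))\<^sup>2)"
    by (simp add: norm_mult sum_distrib_left)
  also have "(\<Sum>x1\<in>X1. \<Sum>y2\<in>X2. (cmod (g x1 y2))\<^sup>2)
      = (\<Sum>y2\<in>X2. fourier_energy N1 X1 (\<lambda>y1. u (y2 + N2 * y1)))"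
    unfolding fourier_energy_def g_def by (rule sum.swap)
  also have "real N2 * ?r2\<^sup>2 * \<dots> \<le> real N2 * ?r2\<^sup>2 *
      (\<Sum>y2\<in>X2. real N1 * ?r1\<^sup>2 * (\<Sum>y1\<in>X1. (cmod (u (y2 + N2 * y1)))\<^sup>2))"
    by (intro mult_left_mono sum_mono fourier_energy_le X1 N1) auto
  also have "\<dots> = real (N1 * N2) * (?r1 * ?r2)\<^sup>2 * (\<Sum>y2\<in>X2. \<Sum>y1\<in>X1. (cmod (u (y2 + N2 * y1)))\<^sup>2)"
    by (simp add: sum_distrib_left power_mult_distrib mult_ac)
  also have "(\<Sum>y2\<in>X2. \<Sum>y1\<in>X1. (cmod (u (y2 + N2 * y1)))\<^sup>2) = (\<Sum>l\<in>X. (cmod (u l))\<^sup>2)"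
    unfolding X_snd sum_digits[OF X2] ..
  finally show "fourier_energy (N1 * N2) X u
      \<le> real (N1 * N2) * (?r1 * ?r2)\<^sup>2 * (\<Sum>l\<in>X. (cmod (u l))\<^sup>2)" .
qed

section \<open>Cantor sets and their norms\<close>

lemma cantor_set_add:
  "cantor_set M A (m + n) = (\<lambda>(x, y). x + M ^ m * y) ` (cantor_set M A m \<times> cantor_set M A n)"
proof -
  have split: "(\<Sum>j<m + n. a j * M ^ j) = (\<Sum>j<m. a j * M ^ j) + M ^ m * (\<Sum>j<n. a (m + j) * M ^ j)"
    for a :: "nat \<Rightarrow> nat"
  proof (induction n)
    case (Suc n)
    then show ?case by (simp add: distrib_left power_add mult_ac)
  qed simp
  show ?thesis
  proof (intro equalityI subsetI)
    fix z assume "z \<in> cantor_set M A (m + n)"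
    then obtain a where a: "\<forall>j<m + n. a j \<in> A" and z: "z = (\<Sum>j<m + n. a j * M ^ j)"
      unfolding cantor_set_def by blast
    have "(\<Sum>j<m. a j * M ^ j) \<in> cantor_set M A m"
      unfolding cantor_set_def using a by fastforce
    moreover have "(\<Sum>j<n. a (m + j) * M ^ j) \<in> cantor_set M A n"
      unfolding cantor_set_def using a by (intro CollectI exI[of _ "\<lambda>j. a (m + j)"]) auto
    ultimately show "z \<in> (\<lambda>(x, y). x + M ^ m * y) ` (cantor_set M A m \<times> cantor_set M A n)"
      unfolding z split by force
  next
    fix z assume "z \<in> (\<lambda>(x, y). x + M ^ m * y) ` (cantor_set M A m \<times> cantor_set M A n)"
    then obtain a b where a: "\<forall>j<m. a j \<in> A" and b: "\<forall>j<n. b j \<in> A"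
      and z: "z = (\<Sum>j<m. a j * M ^ j) + M ^ m * (\<Sum>j<n. b j * M ^ j)"
      unfolding cantor_set_def by auto
    define c where "c j = (if j < m then a j else b (j - m))" for j
    have "z = (\<Sum>j<m + n. c j * M ^ j)" unfolding split z by (simp add: c_def)
    moreover have "\<forall>j<m + n. c j \<in> A" using a b by (auto simp: c_def)
    ultimately show "z \<in> cantor_set M A (m + n)" unfolding cantor_set_def by blast
  qed
qed

lemma cantor_set_1: "cantor_set M A 1 = A"
proof -
  have "x \<in> cantor_set M A 1" if "x \<in> A" for x
    unfolding cantor_set_def using that by (intro CollectI exI[of _ "\<lambda>_. x"]) simp
  then show ?thesis by (auto simp: cantor_set_def)
qed

lemma cantor_set_less:
  assumes "A \<subseteq> {..<M}"
  shows "cantor_set M A k \<subseteq> {..<M ^ k}"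
proof (induction k)
  case 0
  show ?case by (auto simp: cantor_set_def)
next
  case (Suc k)
  have "x + M ^ k * y < M ^ Suc k" if "x < M ^ k" "y < M" for x y
  proof -
    have "x + M ^ k * y < M ^ k * Suc y" using that by simp
    also have "\<dots> \<le> M ^ k * M" using that by (intro mult_left_mono) auto
    finally show ?thesis by (simp add: mult.commute)
  qed
  moreover have "cantor_set M A (Suc k) = (\<lambda>(x, y). x + M ^ k * y) ` (cantor_set M A k \<times> A)"
    using cantor_set_add[of M A k 1] unfolding cantor_set_1 Suc_eq_plus1 .
  ultimately show ?case
    using Suc assms by (simp only: image_subset_iff) (simp add: subset_iff)
qed

lemma cantor_set_nonempty:
  assumes "A \<noteq> {}"
  shows "cantor_set M A k \<noteq> {}"
proof -
  obtain x where "x \<in> A" using assms by blast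
  then have "(\<Sum>j<k. x * M ^ j) \<in> cantor_set M A k"
    unfolding cantor_set_def by (intro CollectI exI[of _ "\<lambda>_. x"]) simp
  then show ?thesis by blast
qed

lemma cantor_norm_eq: "cantor_norm M A k = fourier_norm (M ^ k) (cantor_set M A k)"
  by (simp add: cantor_norm_def fourier_norm_def)

lemma cantor_norm_submult:
  assumes "A \<subseteq> {..<M}" "M > 0"
  shows "cantor_norm M A (m + n) \<le> cantor_norm M A m * cantor_norm M A n"
proof -
  have "cantor_set M A (m + n) \<subseteq> {..<M ^ m * M ^ n}"
    using cantor_set_less[OF assms(1), of "m + n"] by (simp add: power_add)
  moreover have "cantor_set M A (m + n)
      = (\<lambda>(x, y). x + M ^ n * y) ` (cantor_set M A n \<times> cantor_set M A m)"
    by (subst add.commute) (rule cantor_set_add)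
  moreover have "M ^ m > 0" "M ^ n > 0" using assms(2) by simp_all
  ultimately show ?thesis
    unfolding cantor_norm_eq power_add
    by (intro fourier_norm_mult_le[OF cantor_set_less[OF assms(1)] cantor_set_less[OF assms(1)] _ _
          cantor_set_add])
qed

lemma cantor_norm_lower:
  assumes "A \<subseteq> {..<M}" "M > 0" "A \<noteq> {}"
  shows "1 / sqrt (real M ^ k) \<le> cantor_norm M A k"
  using fourier_norm_lower[OF cantor_set_less[OF assms(1)], of k] assms
  by (simp add: cantor_norm_eq cantor_set_nonempty)

lemma cantor_norm_pos:
  assumes "A \<subseteq> {..<M}" "M > 0" "A \<noteq> {}"
  shows "cantor_norm M A k > 0"
proof -
  have "1 / sqrt (real M ^ k) > 0" using assms(2) by simp
  then show ?thesis using cantor_norm_lower[OF assms, of k] by linarith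
qed

section \<open>Fekete's lemma and the exponent\<close>

lemma subadditive_mult_le:
  fixes a :: "nat \<Rightarrow> real"
  assumes sub: "\<And>m n. a (m + n) \<le> a m + a n"
  shows "a (q * m + s) \<le> real q * a m + a s"
proof (induction q)
  case (Suc q)
  have "a (Suc q * m + s) \<le> a m + a (q * m + s)"
    using sub[of m "q * m + s"] by (simp add: add_ac)
  then show ?case using Suc by (simp add: algebra_simps)
qed simp

text \<open>
  The limit is the infimum of \<open>a n / n\<close>. If \<open>a m / m\<close> is within \<open>\<epsilon> / 2\<close> of it, then division with
  remainder of \<open>n\<close> by \<open>m\<close> bounds \<open>a n\<close> by \<open>n (L + \<epsilon> / 2)\<close> plus a constant that depends
  only on \<open>m\<close>, and dividing by a large \<open>n\<close> absorbs the constant.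
\<close>

lemma fekete:
  fixes a :: "nat \<Rightarrow> real"
  assumes sub: "\<And>m n. a (m + n) \<le> a m + a n"
    and lower: "\<And>n. n > 0 \<Longrightarrow> B \<le> a n / real n"
  obtains L where "(\<lambda>n. a n / real n) \<longlonglongrightarrow> L" "\<And>n. n > 0 \<Longrightarrow> L \<le> a n / real n"
proof
  define L where "L = (INF n\<in>{0<..}. a n / real n)"
  have bdd: "bdd_below ((\<lambda>n. a n / real n) ` {0<..})"
    using lower by (intro bdd_belowI2) auto
  show L_le: "L \<le> a n / real n" if "n > 0" for n
    unfolding L_def using that by (intro cINF_lower bdd) auto
  show "(\<lambda>n. a n / real n) \<longlonglongrightarrow> L"
  proof (rule LIMSEQ_I)
    fix \<epsilon> :: real assume \<epsilon>: "\<epsilon> > 0"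
    have "\<exists>m\<in>{0<..}. a m / real m < L + \<epsilon> / 2"
      using \<epsilon> bdd unfolding L_def by (subst cINF_less_iff[symmetric]) auto
    then obtain m where m: "m > 0" and am: "a m / real m < L + \<epsilon> / 2" by auto
    \<comment> \<open>The first part bounds \<open>a s\<close> for every remainder \<open>s\<close>; the second corrects \<open>q m\<close> to \<open>n\<close>, with
      an absolute value because \<open>L\<close> may be negative.\<close>
    define C where "C = (\<Sum>s<m. \<bar>a s\<bar>) + real m * \<bar>L + \<epsilon> / 2\<bar>"
    have C: "a n \<le> real n * (L + \<epsilon> / 2) + C" for n
    proof -
      define q s where "q = n div m" and "s = n mod m"
      have n: "n = q * m + s" and s: "s < m" using m by (simp_all add: q_def s_def)
      have "a n \<le> real q * a m + a s" unfolding n by (rule subadditive_mult_le[OF sub])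
      also have "real q * a m \<le> real q * (real m * (L + \<epsilon> / 2))"
        using am m by (intro mult_left_mono) (simp_all add: field_simps)
      also have "\<dots> = real n * (L + \<epsilon> / 2) - real s * (L + \<epsilon> / 2)"
        unfolding n by (simp add: algebra_simps)
      also have "- (real s * (L + \<epsilon> / 2)) \<le> real m * \<bar>L + \<epsilon> / 2\<bar>"
      proof -
        have "- (real s * (L + \<epsilon> / 2)) \<le> real s * \<bar>L + \<epsilon> / 2\<bar>"
          by (metis abs_ge_minus_self abs_mult abs_of_nat)
        also have "\<dots> \<le> real m * \<bar>L + \<epsilon> / 2\<bar>" using s by (intro mult_right_mono) auto
        finally show ?thesis .
      qed
      moreover have "a s \<le> (\<Sum>s<m. \<bar>a s\<bar>)"
        using s member_le_sum[of s "{..<m}" "\<lambda>s. \<bar>a s\<bar>"] by force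
      ultimately show ?thesis unfolding C_def by linarith
    qed
    obtain n0 where n0: "real n0 > 2 * C / \<epsilon>" using reals_Archimedean2 by blast
    show "\<exists>no. \<forall>n\<ge>no. norm (a n / real n - L) < \<epsilon>"
    proof (intro exI allI impI)
      fix n assume n: "n \<ge> Suc n0"
      have "C < real n * (\<epsilon> / 2)"
      proof -
        have "C < real n0 * (\<epsilon> / 2)" using n0 \<epsilon> by (simp add: field_simps)
        also have "\<dots> \<le> real n * (\<epsilon> / 2)" using n \<epsilon> by (intro mult_right_mono) auto
        finally show ?thesis .
      qed
      then have "a n < real n * (L + \<epsilon>)" using C[of n] by (simp add: algebra_simps)
      then have "a n / real n < L + \<epsilon>" using n by (simp add: field_simps)
      moreover have "L \<le> a n / real n" using L_le n by simp
      ultimately show "norm (a n / real n - L) < \<epsilon>" by simp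
    qed
  qed
qed

text \<open>
  The exponent is minus the limit of \<open>ln r\<^sub>k / (k ln M)\<close>, and this limit is at most every term with \<open>k > 0\<close>.
  The lower bound on \<open>r\<^sub>k\<close> is what makes the limit finite, so that \<^const>\<open>lim\<close> denotes it.
\<close>

lemma fup_exponent_ge:
  assumes A: "A \<subseteq> {..<M}" and M: "M > 1" and ne: "A \<noteq> {}" and k: "k > 0"
  shows "fup_exponent M A \<ge> - (ln (cantor_norm M A k) / (real k * ln (real M)))"
proof -
  define a where "a n = ln (cantor_norm M A n)" for n
  have M0: "M > 0" using M by simp
  note low = cantor_norm_lower[OF A M0 ne]
  have pos: "cantor_norm M A n > 0" for n
    by (rule cantor_norm_pos[OF A M0 ne])
  have sub: "a (m + n) \<le> a m + a n" for m n
  proof -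
    have "ln (cantor_norm M A (m + n)) \<le> ln (cantor_norm M A m * cantor_norm M A n)"
      using cantor_norm_submult[OF A M0, of m n] pos[of "m + n"] by (rule ln_mono)
    also have "\<dots> = a m + a n"
      using pos[of m] pos[of n] by (simp add: a_def ln_mult)
    finally show ?thesis by (simp add: a_def)
  qed
  have lower: "- ln (real M) / 2 \<le> a n / real n" if "n > 0" for n
  proof -
    have "ln (1 / sqrt (real M ^ n)) \<le> a n"
      unfolding a_def using low[of n] pos[of n] M by (subst ln_le_cancel_iff) auto
    moreover have "ln (1 / sqrt (real M ^ n)) = - (real n * ln (real M) / 2)"
      using M by (simp add: ln_div ln_sqrt ln_realpow)
    ultimately show ?thesis using that by (simp add: field_simps)
  qed
  obtain L where L: "(\<lambda>n. a n / real n) \<longlonglongrightarrow> L" and Lle: "\<And>n. n > 0 \<Longrightarrow> L \<le> a n / real n"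
    using fekete[of a, OF sub lower] by blast
  have "(\<lambda>n. a n / real n / ln (real M)) \<longlonglongrightarrow> L / ln (real M)"
    using L M by (intro tendsto_divide tendsto_const) auto
  then have "fup_exponent M A = - (L / ln (real M))"
    unfolding fup_exponent_def a_def by (simp add: limI)
  moreover have "L / ln (real M) \<le> a k / real k / ln (real M)"
    using Lle[OF k] M by (intro divide_right_mono) auto
  ultimately show ?thesis by (simp add: a_def)
qed

section \<open>Gain over the Hilbert--Schmidt bound\<close>

text \<open>
  Schur's test for the Gram matrix of the columns: the left-hand side is its quadratic form, the Gram
  matrix is Hermitian, and estimating \<open>cmod (u l) * cmod (u l')\<close> by the mean of the squares leaves only its row sums.
  Working with the Gram matrix rather than with \<open>c\<close> itself matters: when all entries of \<open>c\<close> have the same modulus,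
  cancellation is visible only after summing over \<open>j\<close>.
\<close>

lemma schur_gram:
  fixes c :: "'a \<Rightarrow> 'b \<Rightarrow> complex"
  assumes "\<And>l. l \<in> X \<Longrightarrow> (\<Sum>l'\<in>X. cmod (\<Sum>j\<in>Y. c j l * cnj (c j l'))) \<le> R"
  shows "(\<Sum>j\<in>Y. (cmod (\<Sum>l\<in>X. c j l * u l))\<^sup>2) \<le> R * (\<Sum>l\<in>X. (cmod (u l))\<^sup>2)"
proof -
  define G where "G l l' = (\<Sum>j\<in>Y. c j l * cnj (c j l'))" for l l'
  have sym: "cmod (G l' l) = cmod (G l l')" for l l'
  proof -
    have "G l' l = cnj (G l l')" by (simp add: G_def mult.commute)
    then show ?thesis by simp
  qed
  have "complex_of_real (\<Sum>j\<in>Y. (cmod (\<Sum>l\<in>X. c j l * u l))\<^sup>2)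
      = (\<Sum>j\<in>Y. (\<Sum>l\<in>X. c j l * u l) * cnj (\<Sum>l\<in>X. c j l * u l))"
    by (simp only: of_real_sum complex_norm_square)
  also have "\<dots> = (\<Sum>j\<in>Y. \<Sum>l\<in>X. \<Sum>l'\<in>X. c j l * cnj (c j l') * (u l * cnj (u l')))"
    by (simp add: sum_product mult_ac)
  also have "\<dots> = (\<Sum>l\<in>X. \<Sum>j\<in>Y. \<Sum>l'\<in>X. c j l * cnj (c j l') * (u l * cnj (u l')))"
    by (rule sum.swap)
  also have "\<dots> = (\<Sum>l\<in>X. \<Sum>l'\<in>X. \<Sum>j\<in>Y. c j l * cnj (c j l') * (u l * cnj (u l')))"
    by (intro sum.cong refl sum.swap)
  also have "\<dots> = (\<Sum>l\<in>X. \<Sum>l'\<in>X. G l l' * (u l * cnj (u l')))"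
    by (simp add: G_def sum_distrib_right)
  finally have eq: "complex_of_real (\<Sum>j\<in>Y. (cmod (\<Sum>l\<in>X. c j l * u l))\<^sup>2)
      = (\<Sum>l\<in>X. \<Sum>l'\<in>X. G l l' * (u l * cnj (u l')))" .
  have "(\<Sum>j\<in>Y. (cmod (\<Sum>l\<in>X. c j l * u l))\<^sup>2)
      = cmod (complex_of_real (\<Sum>j\<in>Y. (cmod (\<Sum>l\<in>X. c j l * u l))\<^sup>2))"
    by (simp only: norm_of_real) (simp add: sum_nonneg)
  also have "\<dots> \<le> (\<Sum>l\<in>X. \<Sum>l'\<in>X. cmod (G l l' * (u l * cnj (u l'))))"
    unfolding eq by (intro order_trans[OF norm_sum] sum_mono norm_sum)
  also have "\<dots> \<le> (\<Sum>l\<in>X. \<Sum>l'\<in>X. cmod (G l l') * ((cmod (u l))\<^sup>2 / 2) + cmod (G l l') * ((cmod (u l'))\<^sup>2 / 2))"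
  proof (intro sum_mono)
    fix l l'
    have "cmod (u l) * cmod (u l') \<le> (cmod (u l))\<^sup>2 / 2 + (cmod (u l'))\<^sup>2 / 2"
      using sum_squares_bound[of "cmod (u l)" "cmod (u l')"] by simp
    then have "cmod (G l l') * (cmod (u l) * cmod (u l'))
        \<le> cmod (G l l') * ((cmod (u l))\<^sup>2 / 2 + (cmod (u l'))\<^sup>2 / 2)"
      by (intro mult_left_mono) auto
    then show "cmod (G l l' * (u l * cnj (u l')))
        \<le> cmod (G l l') * ((cmod (u l))\<^sup>2 / 2) + cmod (G l l') * ((cmod (u l'))\<^sup>2 / 2)"
      by (simp add: norm_mult distrib_left)
  qed
  also have "\<dots> = (\<Sum>l\<in>X. \<Sum>l'\<in>X. cmod (G l l') * ((cmod (u l))\<^sup>2 / 2))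
      + (\<Sum>l\<in>X. \<Sum>l'\<in>X. cmod (G l l') * ((cmod (u l'))\<^sup>2 / 2))"
    by (simp add: sum.distrib)
  also have "(\<Sum>l\<in>X. \<Sum>l'\<in>X. cmod (G l l') * ((cmod (u l'))\<^sup>2 / 2))
      = (\<Sum>l\<in>X. \<Sum>l'\<in>X. cmod (G l l') * ((cmod (u l))\<^sup>2 / 2))"
    by (subst sum.swap) (simp add: sym)
  also have "(\<Sum>l\<in>X. \<Sum>l'\<in>X. cmod (G l l') * ((cmod (u l))\<^sup>2 / 2))
      + (\<Sum>l\<in>X. \<Sum>l'\<in>X. cmod (G l l') * ((cmod (u l))\<^sup>2 / 2))
      = (\<Sum>l\<in>X. (\<Sum>l'\<in>X. cmod (G l l')) * (cmod (u l))\<^sup>2)"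
    by (simp add: sum_distrib_right flip: sum.distrib)
  also have "\<dots> \<le> (\<Sum>l\<in>X. R * (cmod (u l))\<^sup>2)"
    using assms by (intro sum_mono mult_right_mono) (auto simp: G_def)
  finally show ?thesis by (simp add: sum_distrib_left)
qed

text \<open>
  The powers of \<open>z\<close> sum to 0, so the numbers \<open>1 - z ^ k\<close> with \<open>k < Q\<close> sum to \<open>Q\<close>. Each of them is at
  most \<open>k\<close> times as large as \<open>1 - z\<close>, hence \<open>Q \<le> (Q\<^sup>2 / 2) * cmod (1 - z)\<close>.
\<close>

lemma norm_1_minus_root_of_unity:
  fixes z :: complex
  assumes "z ^ Q = 1" "z \<noteq> 1" "Q > 0"
  shows "2 / real Q \<le> cmod (1 - z)"
proof -
  have z1: "cmod z = 1" 
    using assms by (metis power_eq_1_iff less_numeral_extra(3))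
  have step: "cmod (1 - z ^ k) \<le> real k * cmod (1 - z)" for k
  proof (induction k)
    case (Suc k)
    have "1 - z ^ Suc k = (1 - z) + z * (1 - z ^ k)" by (simp add: algebra_simps)
    then have "cmod (1 - z ^ Suc k) \<le> cmod (1 - z) + cmod (z * (1 - z ^ k))"
      by (simp only: norm_triangle_ineq)
    also have "cmod (z * (1 - z ^ k)) \<le> real k * cmod (1 - z)"
      using Suc z1 by (simp only: norm_mult mult_1)
    finally show ?case by (simp add: algebra_simps)
  qed simp
  have "(\<Sum>k<Q. z ^ k) = 0" using assms by (simp add: geometric_sum)
  then have "real Q = cmod (\<Sum>k<Q. 1 - z ^ k)" by (simp add: sum_subtractf)
  also have "\<dots> \<le> (\<Sum>k<Q. real k * cmod (1 - z))"
    by (intro order_trans[OF norm_sum] sum_mono step)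
  also have "\<dots> = (\<Sum>k<Q. real k) * cmod (1 - z)" by (simp add: sum_distrib_right)
  also have "(\<Sum>k<Q. real k) \<le> real Q * real Q / 2"
    by (induction Q) (simp_all add: field_simps)
  finally have "real Q \<le> real Q * real Q / 2 * cmod (1 - z)" by (simp add: mult_right_mono)
  then show ?thesis using assms by (simp add: field_simps)
qed

text \<open>By the parallelogram law, distance from 1 keeps \<open>1 + z\<close> shorter than 2.\<close>

lemma norm_1_plus_root_of_unity:
  fixes z :: complex
  assumes "z ^ Q = 1" "z \<noteq> 1" "Q > 0"
  shows "cmod (1 + z) \<le> 2 - 1 / (real Q)\<^sup>2"
proof (rule power2_le_imp_le)
  have z1: "cmod z = 1" 
    using assms by (metis power_eq_1_iff less_numeral_extra(3))
  have "(2 / real Q)\<^sup>2 \<le> (cmod (1 - z))\<^sup>2"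
    by (intro power_mono norm_1_minus_root_of_unity assms) simp
  moreover have "(cmod (1 + z))\<^sup>2 + (cmod (1 - z))\<^sup>2 = 4"
  proof -
    have "(Re z)\<^sup>2 + (Im z)\<^sup>2 = 1" using z1 cmod_power2[of z] by simp
    then show ?thesis by (simp add: cmod_power2 power2_sum power2_diff)
  qed
  ultimately have "(cmod (1 + z))\<^sup>2 \<le> 4 - 4 / (real Q)\<^sup>2"
    by (simp add: power_divide)
  also have "\<dots> \<le> (2 - 1 / (real Q)\<^sup>2)\<^sup>2" by (simp add: power2_eq_square algebra_simps)
  finally show "(cmod (1 + z))\<^sup>2 \<le> (2 - 1 / (real Q)\<^sup>2)\<^sup>2" .
  have "1 / (real Q)\<^sup>2 \<le> 1" using assms by simp
  then show "0 \<le> 2 - 1 / (real Q)\<^sup>2" by linarith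
qed


text \<open>
  Row \<open>l\<close> of the Gram matrix has the entries \<open>S l' = (\<Sum>j\<in>X. ep (j * (l - l') / Q))\<close>, trivially of modulus at most
  \<open>card X\<close>. In the column of the partner \<open>m\<close> of \<open>l\<close>, the two summands \<open>j = l\<close> and \<open>j = m\<close> differ by the factor
  \<open>ep ((l - m)\<^sup>2 / Q)\<close>, a nontrivial root of unity, so that they cannot add up to modulus 2. One such
  entry in each row suffices.
\<close>

lemma fourier_energy_le_gap:
  assumes X: "finite X" and Q: "Q > 0"
    and partner: "\<And>l. l \<in> X \<Longrightarrow> \<exists>m\<in>X. \<not> int Q dvd (int l - int m)\<^sup>2"
  shows "fourier_energy Q X u \<le> ((real (card X))\<^sup>2 - 1 / (real Q)\<^sup>2) * (\<Sum>l\<in>X. (cmod (u l))\<^sup>2)"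
  unfolding fourier_energy_def
proof (rule schur_gram)
  fix l assume l: "l \<in> X"
  obtain m where m: "m \<in> X" and ndvd: "\<not> int Q dvd (int l - int m)\<^sup>2"
    using partner[OF l] by blast
  have lm: "l \<noteq> m" using ndvd by auto
  let ?n = "real (card X)"
  define S where "S l' = (\<Sum>j\<in>X. ep (real j * (real l - real l') / real Q))" for l'
  have S: "(\<Sum>j\<in>X. ep (real j * real l / real Q) * cnj (ep (real j * real l' / real Q))) = S l'" for l'
    by (simp add: S_def cnj_ep diff_divide_distrib right_diff_distrib flip: ep_add)
  have trivial: "cmod (\<Sum>j\<in>Y. ep (f j)) \<le> real (card Y)" for Y and f :: "nat \<Rightarrow> real"
    using norm_sum[of "\<lambda>j. ep (f j)" Y] by simp
  define z where "z = ep ((real l - real m)\<^sup>2 / real Q)"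
  have "z ^ Q = ep (real (nat ((int l - int m)\<^sup>2)))"
    using Q by (simp add: z_def ep_power)
  then have zQ: "z ^ Q = 1" by (simp only: ep_of_nat)
  have z: "z \<noteq> 1"
  proof
    assume "z = 1"
    then obtain k :: int where "(real l - real m)\<^sup>2 / real Q = of_int k"
      unfolding z_def using ep_eq_1_imp_int Ints_cases by metis
    then have "real_of_int ((int l - int m)\<^sup>2) = real_of_int (k * int Q)"
      using Q by (simp add: field_simps)
    then have "(int l - int m)\<^sup>2 = k * int Q" by (simp only: of_int_eq_iff)
    then show False using ndvd by simp
  qed
  have "S m = (\<Sum>j\<in>X - {l, m}. ep (real j * (real l - real m) / real Q))
      + (\<Sum>j\<in>{l, m}. ep (real j * (real l - real m) / real Q))"
    unfolding S_def using X l m by (intro sum.subset_diff) auto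
  also have "(\<Sum>j\<in>{l, m}. ep (real j * (real l - real m) / real Q))
      = ep (real m * (real l - real m) / real Q) * (1 + z)"
  proof -
    have "real l * (real l - real m) / real Q
        = real m * (real l - real m) / real Q + (real l - real m)\<^sup>2 / real Q"
    proof -
      have "real l * (real l - real m) = real m * (real l - real m) + (real l - real m)\<^sup>2"
        by (simp add: power2_eq_square algebra_simps)
      then show ?thesis by (simp only: add_divide_distrib)
    qed
    then have "ep (real l * (real l - real m) / real Q) = ep (real m * (real l - real m) / real Q) * z"
      unfolding z_def by (simp only: ep_add)
    then show ?thesis using lm by (simp add: distrib_left)
  qed
  finally have "cmod (S m) \<le> cmod (\<Sum>j\<in>X - {l, m}. ep (real j * (real l - real m) / real Q))
      + cmod (ep (real m * (real l - real m) / real Q) * (1 + z))"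
    by (simp only: norm_triangle_ineq)
  then have "cmod (S m) \<le> real (card (X - {l, m})) + cmod (1 + z)"
    using trivial[of "\<lambda>j. real j * (real l - real m) / real Q" "X - {l, m}"]
    unfolding norm_mult norm_ep by linarith
  moreover have "real (card (X - {l, m})) = ?n - 2"
  proof -
    have "card {l, m} \<le> card X" using X l m by (intro card_mono) auto
    then show ?thesis using X l m lm by (simp add: card_Diff_subset of_nat_diff)
  qed
  ultimately have Sm: "cmod (S m) \<le> ?n - 1 / (real Q)\<^sup>2"
    using norm_1_plus_root_of_unity[OF zQ z Q] by linarith
  have "(\<Sum>l'\<in>X. cmod (S l')) = cmod (S m) + (\<Sum>l'\<in>X - {m}. cmod (S l'))"
    using X m by (rule sum.remove)
  also have "(\<Sum>l'\<in>X - {m}. cmod (S l')) \<le> (\<Sum>l'\<in>X - {m}. ?n)"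
    unfolding S_def by (intro sum_mono trivial)
  also have "(\<Sum>l'\<in>X - {m}. ?n) = (?n - 1) * ?n"
  proof -
    have "card X > 0" using X m card_gt_0_iff by blast
    then have "real (card (X - {m})) = ?n - 1"
      using m by (simp add: card_Diff_singleton)
    then show ?thesis by simp
  qed
  finally have "(\<Sum>l'\<in>X. cmod (S l')) \<le> ?n\<^sup>2 - 1 / (real Q)\<^sup>2"
    using Sm by (simp add: power2_eq_square algebra_simps)
  then show "(\<Sum>l'\<in>X. cmod (\<Sum>j\<in>X. ep (real j * real l / real Q) * cnj (ep (real j * real l' / real Q))))
      \<le> ?n\<^sup>2 - 1 / (real Q)\<^sup>2"
    unfolding S .
qed

lemma fourier_norm_gap:
  assumes X: "X \<subseteq> {..<N}" and N: "N > 0" and "X \<noteq> {}"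
    and partner: "\<And>l. l \<in> X \<Longrightarrow> \<exists>m\<in>X. \<not> int N dvd (int l - int m)\<^sup>2"
  shows "fourier_norm N X \<le> sqrt (((real (card X))\<^sup>2 - 1 / (real N)\<^sup>2) / real N)"
proof (rule fourier_norm_leI[OF X N])
  have fin: "finite X" using X finite_subset by blast
  have "1 / (real N)\<^sup>2 \<le> 1" using N by simp
  moreover have "1 \<le> (real (card X))\<^sup>2"
    using fin \<open>X \<noteq> {}\<close> by (simp add: Suc_leI card_gt_0_iff)
  ultimately have nonneg: "0 \<le> ((real (card X))\<^sup>2 - 1 / (real N)\<^sup>2) / real N"
    by (intro divide_nonneg_nonneg) linarith+
  then show "0 \<le> sqrt (((real (card X))\<^sup>2 - 1 / (real N)\<^sup>2) / real N)" by simp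
  have "real N * (sqrt (((real (card X))\<^sup>2 - 1 / (real N)\<^sup>2) / real N))\<^sup>2
      = (real (card X))\<^sup>2 - 1 / (real N)\<^sup>2"
    using nonneg N by (subst real_sqrt_pow2) auto
  then show "fourier_energy N X u \<le> real N * (sqrt (((real (card X))\<^sup>2 - 1 / (real N)\<^sup>2) / real N))\<^sup>2
      * (\<Sum>l\<in>X. (cmod (u l))\<^sup>2)" for u
    using fourier_energy_le_gap[OF fin N partner] by simp
qed

text \<open>
  The partner of an element of the Cantor set is obtained by changing its lowest digit: the difference
  is then nonzero and less than \<open>M\<close> in absolute value, so \<open>M\<^sup>2\<close> does not divide its square.
\<close>

lemma cantor_norm_2_le:
  assumes A: "A \<subseteq> {..<M}" and card: "card A > 1"
  shows "ln (cantor_norm M A 2) \<le> 2 * ln (real (card A)) - ln (real M) - 1 / (2 * real M ^ 8)"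
proof -
  let ?C = "cantor_set M A 2" and ?n = "real (card A)"
  have card_le: "card A \<le> M" using card_mono[OF _ A] by simp
  have M: "M > 1" and n: "?n > 1" using card card_le by auto
  have C_eq: "?C = (\<lambda>(x, y). x + M * y) ` (A \<times> A)"
    using cantor_set_add[of M A 1 1] unfolding cantor_set_1 one_add_one power_one_right .
  have card_C: "card ?C = (card A)\<^sup>2"
    unfolding C_eq by (simp add: card_image[OF inj_on_digits[OF A]] card_cartesian_product power2_eq_square)
  have C: "?C \<subseteq> {..<M\<^sup>2}" by (rule cantor_set_less[OF A])
  have ne: "A \<noteq> {}" using card by auto
  have partner: "\<exists>m\<in>?C. \<not> int (M\<^sup>2) dvd (int l - int m)\<^sup>2" if lC: "l \<in> ?C" for l
  proof -
    obtain a b where a: "a \<in> A" and b: "b \<in> A" and l: "l = a + M * b"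
      using lC unfolding C_eq by auto
    obtain a' where a': "a' \<in> A" "a' \<noteq> a"
    proof -
      have "\<not> A \<subseteq> {a}" using card card_mono[of "{a}" A] by auto
      then show ?thesis using that by blast
    qed
    have "int l - int (a' + M * b) = int a - int a'" by (simp add: l)
    moreover have "\<not> int (M\<^sup>2) dvd (int a - int a')\<^sup>2"
    proof
      assume "int (M\<^sup>2) dvd (int a - int a')\<^sup>2"
      then have "int M dvd int a - int a'" by simp
      moreover have "\<bar>int a - int a'\<bar> < int M"
      proof -
        have "a < M" "a' < M" using A a a' by auto
        then show ?thesis by linarith
      qed
      ultimately have "int a - int a' = 0" using zdvd_not_zless[of "\<bar>int a - int a'\<bar>" "int M"] by force
      then show False using a' by simp
    qed
    ultimately have "\<not> int (M\<^sup>2) dvd (int l - int (a' + M * b))\<^sup>2" by (simp only: not_False_eq_True)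
    moreover have "a' + M * b \<in> ?C" using a' b unfolding C_eq by auto
    ultimately show ?thesis by blast
  qed
  define s where "s = 1 / real M ^ 4"
  have "cantor_norm M A 2 \<le> sqrt ((?n ^ 4 - s) / (real M)\<^sup>2)"
    using fourier_norm_gap[OF C _ _ partner] M ne
    by (simp add: cantor_norm_eq card_C s_def cantor_set_nonempty flip: power_mult)
  moreover have pos: "cantor_norm M A 2 > 0"
    using cantor_norm_pos[OF A _ ne] M by simp
  ultimately have "ln (cantor_norm M A 2) \<le> ln (sqrt ((?n ^ 4 - s) / (real M)\<^sup>2))"
    by (rule ln_mono)
  have s: "0 < s" "s \<le> 1" using M by (simp_all add: s_def)
  have n4: "?n ^ 4 > 1" using n by simp
  have pos_gap: "?n ^ 4 - s > 0" using s n4 by linarith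
  have "ln (sqrt ((?n ^ 4 - s) / (real M)\<^sup>2)) = (ln (?n ^ 4 - s) - 2 * ln (real M)) / 2"
    using pos_gap M by (simp add: ln_sqrt ln_div ln_realpow)
  also have "ln (?n ^ 4 - s) \<le> 4 * ln ?n - 1 / real M ^ 8"
  proof -
    have "?n ^ 4 - s = ?n ^ 4 * (1 - s / ?n ^ 4)" using n by (simp add: field_simps)
    moreover have "1 - s / ?n ^ 4 > 0"
    proof -
      have "s / ?n ^ 4 < 1" using pos_gap n4 by (subst divide_less_eq_1_pos) linarith+
      then show ?thesis by simp
    qed
    ultimately have "ln (?n ^ 4 - s) = 4 * ln ?n + ln (1 - s / ?n ^ 4)"
      using n by (simp add: ln_mult ln_realpow)
    moreover have "ln (1 - s / ?n ^ 4) \<le> - (s / ?n ^ 4)"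
      using ln_le_minus_one[OF \<open>1 - s / ?n ^ 4 > 0\<close>] by simp
    moreover have "1 / real M ^ 8 \<le> s / ?n ^ 4"
    proof -
      have "?n ^ 4 \<le> real M ^ 4" using card_le by (intro power_mono) auto
      then have "real M ^ 4 * ?n ^ 4 \<le> real M ^ 4 * real M ^ 4" by (intro mult_left_mono) auto
      also have "\<dots> = real M ^ 8" by (simp flip: power_add)
      finally have "1 / real M ^ 8 \<le> 1 / (real M ^ 4 * ?n ^ 4)"
        using M n by (intro divide_left_mono) auto
      then show ?thesis by (simp add: s_def)
    qed
    ultimately show ?thesis by linarith
  qed
  finally have "ln (sqrt ((?n ^ 4 - s) / (real M)\<^sup>2))
      \<le> 2 * ln ?n - ln (real M) - 1 / (2 * real M ^ 8)" by (simp add: field_simps)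
  then show ?thesis
    using \<open>ln (cantor_norm M A 2) \<le> ln (sqrt ((?n ^ 4 - s) / (real M)\<^sup>2))\<close> by linarith
qed

theorem corollary3p5:
  shows "\<exists>K::real. K > 0 \<and>
    (\<forall>(M::nat) (A::nat set). A \<subseteq> {0..<M} \<longrightarrow> 1 < card A \<longrightarrow> card A < M \<longrightarrow>
       fup_exponent M A \<ge> - (ln (cantor_norm M A 2) / (2 * ln (real M))) \<and>
       - (ln (cantor_norm M A 2) / (2 * ln (real M)))
         \<ge> 1 / 2 - cantor_dim M A + 1 / (K * real M ^ 8 * ln (real M)))"
  \<comment> \<open>The gain in \<open>ln r\<^sub>2\<close> is \<open>1 / (2 * M ^ 8)\<close>, and dividing by \<open>2 * ln M\<close> turns 2 into 4.\<close>
proof (intro exI[of _ 4] conjI allI impI)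
  fix M :: nat and A :: "nat set"
  assume "A \<subseteq> {0..<M}" and card: "1 < card A" "card A < M"
  then have A: "A \<subseteq> {..<M}" by auto
  have M: "M > 1" and ne: "A \<noteq> {}" using card by auto
  show "fup_exponent M A \<ge> - (ln (cantor_norm M A 2) / (2 * ln (real M)))"
    using fup_exponent_ge[OF A M ne, of 2] by simp
  have lnM: "ln (real M) > 0" using M by simp
  have "1 / 2 - cantor_dim M A + 1 / (4 * real M ^ 8 * ln (real M))
      = - ((2 * ln (real (card A)) - ln (real M) - 1 / (2 * real M ^ 8)) / (2 * ln (real M)))"
    using lnM M by (simp add: cantor_dim_def field_simps)
  also have "\<dots> \<le> - (ln (cantor_norm M A 2) / (2 * ln (real M)))"
    using cantor_norm_2_le[OF A card(1)] lnM by (intro le_imp_neg_le divide_right_mono) auto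
  finally show "- (ln (cantor_norm M A 2) / (2 * ln (real M)))
      \<ge> 1 / 2 - cantor_dim M A + 1 / (4 * real M ^ 8 * ln (real M))" .
qed simp

end
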